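(* Let $m\ge3$ and $1\le\ell\le\lfloor\frac{m-1}{2}\rfloor$ be integers and $\kappa\in\mathbb{R}$. For every integer $n\ge0$, $$P_n^{(1)}=z^{m-\ell+1}Q_n^{(1)}\left(\kappa,\tfrac{m-\ell}{m};z^m,\overline z^m\right)t+z\overline z^{m-\ell}Q_n^{(2)}\left(\kappa,\tfrac{m-\ell}{m};z^m,\overline z^m\right)\overline t,$$ $$P_n^{(2)}=z^{\ell+1}Q_n^{(1)}\left(\kappa,\tfrac{\ell}{m};z^m,\overline z^m\right)\overline t+z\overline z^{\ell}Q_n^{(2)}\left(\kappa,\tfrac{\ell}{m};z^m,\overline z^m\right)t.$$
   Context: Polynomials considered are of the form $f(z,\overline z,t,\overline t)=f_1(z,\overline z)t+f_2(z,\overline z)\overline t$, and $\sigma_0f(z,\overline z,t,\overline t)=f(\overline z,z,\overline t,t)$. The polynomials $P_n^{(1)},P_n^{(2)}$ $(n\ge0)$ are defined by $$P_0^{(1)}=z^{m-\ell+1}t+\frac{m\kappa}{m-\ell}z\overline z^{m-\ell}\overline t,\qquad P_{n+1}^{(1)}=z^mP_n^{(1)}+\frac{m\kappa}{(n+1)m+(m-\ell)}z\overline z^{m-1}\sigma_0P_n^{(1)},$$ $$P_0^{(2)}=z^{\ell+1}\overline t+\frac{m\kappa}{\ell}z\overline z^{\ell}t,\qquad P_{n+1}^{(2)}=z^mP_n^{(2)}+\frac{m\kappa}{(n+1)m+\ell}z\overline z^{m-1}\sigma_0P_n^{(2)}.$$ For $\lambda>0$ the polynomials $Q_n^{(1)},Q_n^{(2)}$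 in two variables $w,\overline w$ are defined by $Q_0^{(1)}(\kappa,\lambda;w,\overline w)=1$, $Q_0^{(2)}(\kappa,\lambda;w,\overline w)=\frac{\kappa}{\lambda}$, and for $n\ge0$ $$Q_{n+1}^{(1)}(\kappa,\lambda;w,\overline w)=wQ_n^{(1)}(\kappa,\lambda;w,\overline w)+\frac{\kappa}{\lambda+n+1}\overline wQ_n^{(2)}(\kappa,\lambda;\overline w,w),$$ $$Q_{n+1}^{(2)}(\kappa,\lambda;w,\overline w)=\frac{\kappa}{\lambda+n+1}\overline wQ_n^{(1)}(\kappa,\lambda;\overline w,w)+wQ_n^{(2)}(\kappa,\lambda;w,\overline w).$$ *)

theory Defs
  imports Complex_Main "HOL-Library.Poly_Mapping"
begin

text \<open>Polynomials with complex coefficients in the variables \<^typ>\<open>'v\<close>: a monomial is a finitely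
  supported exponent function, and multiplication is convolution.\<close>

type_synonym 'v cpoly = "('v \<Rightarrow>\<^sub>0 nat) \<Rightarrow>\<^sub>0 complex"

definition Const :: "complex \<Rightarrow> 'v cpoly" where
  "Const c = Poly_Mapping.single 0 c"

definition Var :: "'v \<Rightarrow> 'v cpoly" where
  "Var v = Poly_Mapping.single (Poly_Mapping.single v 1) 1"

abbreviation rconst :: "real \<Rightarrow> 'v cpoly" where
  "rconst r \<equiv> Const (complex_of_real r)"

definition psubst :: "('v \<Rightarrow> 'w cpoly) \<Rightarrow> 'v cpoly \<Rightarrow> 'w cpoly" where
  "psubst f p = (\<Sum>\<mu>\<in>Poly_Mapping.keys p. Const (Poly_Mapping.lookup p \<mu>) *
     (\<Prod>v\<in>Poly_Mapping.keys \<mu>. f v ^ Poly_Mapping.lookup \<mu> v))"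

text \<open>The barred variables are independent indeterminates. For polynomials in \<open>z\<close>, \<open>t\<close> and their
  complex conjugates this loses nothing: two of them agree as functions iff they agree formally.
  Exchanging a variable with its bar does not conjugate the coefficients.\<close>

datatype zt_var = Zv | Zbar_v | Tv | Tbar_v

abbreviation Z :: "zt_var cpoly" where "Z \<equiv> Var Zv"
abbreviation Zbar :: "zt_var cpoly" where "Zbar \<equiv> Var Zbar_v"
abbreviation T :: "zt_var cpoly" where "T \<equiv> Var Tv"
abbreviation Tbar :: "zt_var cpoly" where "Tbar \<equiv> Var Tbar_v"

definition sigma0 :: "zt_var cpoly \<Rightarrow> zt_var cpoly" where
  "sigma0 = psubst (\<lambda>v. case v of Zv \<Rightarrow> Zbar | Zbar_v \<Rightarrow> Z | Tv \<Rightarrow> Tbar | Tbar_v \<Rightarrow> T)"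

primrec P1 :: "nat \<Rightarrow> nat \<Rightarrow> real \<Rightarrow> nat \<Rightarrow> zt_var cpoly" where
  "P1 m l \<kappa> 0 = Z ^ (m - l + 1) * T
     + rconst (real m * \<kappa> / (real m - real l)) * Z * Zbar ^ (m - l) * Tbar"
| "P1 m l \<kappa> (Suc n) = Z ^ m * P1 m l \<kappa> n
     + rconst (real m * \<kappa> / ((real n + 1) * real m + (real m - real l)))
         * Z * Zbar ^ (m - 1) * sigma0 (P1 m l \<kappa> n)"

primrec P2 :: "nat \<Rightarrow> nat \<Rightarrow> real \<Rightarrow> nat \<Rightarrow> zt_var cpoly" where
  "P2 m l \<kappa> 0 = Z ^ (l + 1) * Tbar
     + rconst (real m * \<kappa> / real l) * Z * Zbar ^ l * T"
| "P2 m l \<kappa> (Suc n) = Z ^ m * P2 m l \<kappa> n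
     + rconst (real m * \<kappa> / ((real n + 1) * real m + real l))
         * Z * Zbar ^ (m - 1) * sigma0 (P2 m l \<kappa> n)"

datatype w_var = Wv | Wbar_v

abbreviation W :: "w_var cpoly" where "W \<equiv> Var Wv"
abbreviation Wbar :: "w_var cpoly" where "Wbar \<equiv> Var Wbar_v"

definition at_w :: "w_var cpoly \<Rightarrow> 'v cpoly \<Rightarrow> 'v cpoly \<Rightarrow> 'v cpoly" where
  "at_w q a b = psubst (\<lambda>v. case v of Wv \<Rightarrow> a | Wbar_v \<Rightarrow> b) q"

text \<open>Intended for \<open>lam > 0\<close> only; otherwise a denominator may vanish.\<close>

fun Q1 :: "real \<Rightarrow> real \<Rightarrow> nat \<Rightarrow> w_var cpoly"
  and Q2 :: "real \<Rightarrow> real \<Rightarrow> nat \<Rightarrow> w_var cpoly" where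
  "Q1 \<kappa> lam 0 = 1"
| "Q2 \<kappa> lam 0 = rconst (\<kappa> / lam)"
| "Q1 \<kappa> lam (Suc n) = W * Q1 \<kappa> lam n
     + rconst (\<kappa> / (lam + real n + 1)) * Wbar * at_w (Q2 \<kappa> lam n) Wbar W"
| "Q2 \<kappa> lam (Suc n) = rconst (\<kappa> / (lam + real n + 1)) * Wbar * at_w (Q1 \<kappa> lam n) Wbar W
     + W * Q2 \<kappa> lam n"

text \<open>\<^const>\<open>psubst\<close> is the ring homomorphism over the coefficients determined by the images of
  the variables.\<close>

lemma psubst_superset:
  assumes "finite A" "Poly_Mapping.keys p \<subseteq> A"
  shows "psubst f p = (\<Sum>\<mu>\<in>A. Const (Poly_Mapping.lookup p \<mu>) *
     (\<Prod>v\<in>Poly_Mapping.keys \<mu>. f v ^ Poly_Mapping.lookup \<mu> v))"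
  unfolding psubst_def
  by (rule sum.mono_neutral_left) (use assms in \<open>auto simp: in_keys_iff Const_def\<close>)

lemma psubst_add: "psubst f (p + q) = psubst f p + psubst f q"
proof -
  let ?A = "Poly_Mapping.keys p \<union> Poly_Mapping.keys q"
  have "Poly_Mapping.keys (p + q) \<subseteq> ?A" by (rule keys_add)
  then show ?thesis
    by (simp add: psubst_superset[of ?A] lookup_add Const_def single_add distrib_right sum.distrib)
qed

lemma psubst_zero: "psubst f 0 = 0"
  by (simp add: psubst_def)

lemma psubst_single:
  "psubst f (Poly_Mapping.single \<mu> c)
     = Const c * (\<Prod>v\<in>Poly_Mapping.keys \<mu>. f v ^ Poly_Mapping.lookup \<mu> v)"
  by (subst psubst_superset[of "{\<mu>}"]) auto

lemma psubst_Const: "psubst f (Const c) = Const c"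
  by (simp add: Const_def psubst_single)

lemma psubst_one: "psubst f 1 = 1"
  using psubst_Const[of f 1] by (simp add: Const_def)

lemma psubst_Var: "psubst f (Var v) = f v"
  by (simp add: Var_def psubst_single Const_def)

lemma cpoly_induct [case_names zero add]:
  fixes p :: "'v cpoly"
  assumes "Q 0" and "\<And>p \<mu> c. Q p \<Longrightarrow> Q (Poly_Mapping.single \<mu> c + p)"
  shows "Q p"
proof (induction p rule: update_induct)
  case const then show ?case by (rule assms(1))
next
  case (update p \<mu> c)
  have "Poly_Mapping.update \<mu> c p = Poly_Mapping.single \<mu> c + p"
    using update.hyps
    by (intro poly_mapping_eqI) (auto simp: lookup_update lookup_add lookup_single in_keys_iff when_def)
  then show ?case using assms(2) update by simp
qed

lemma monomial_add:
  fixes f :: "'v \<Rightarrow> 'w cpoly" and \<mu> \<nu> :: "'v \<Rightarrow>\<^sub>0 nat"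
  shows "(\<Prod>v\<in>Poly_Mapping.keys (\<mu> + \<nu>). f v ^ Poly_Mapping.lookup (\<mu> + \<nu>) v)
    = (\<Prod>v\<in>Poly_Mapping.keys \<mu>. f v ^ Poly_Mapping.lookup \<mu> v)
      * (\<Prod>v\<in>Poly_Mapping.keys \<nu>. f v ^ Poly_Mapping.lookup \<nu> v)"
proof -
  let ?A = "Poly_Mapping.keys \<mu> \<union> Poly_Mapping.keys \<nu>"
  have *: "(\<Prod>v\<in>Poly_Mapping.keys \<rho>. f v ^ Poly_Mapping.lookup \<rho> v)
      = (\<Prod>v\<in>?A. f v ^ Poly_Mapping.lookup \<rho> v)" if "Poly_Mapping.keys \<rho> \<subseteq> ?A" for \<rho>
    by (rule prod.mono_neutral_left) (use that in \<open>auto simp: in_keys_iff\<close>)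
  show ?thesis
    unfolding *[OF keys_add]
    by (simp add: *[of \<mu>] *[of \<nu>] lookup_add power_add prod.distrib)
qed

lemma psubst_mult:
  fixes f :: "'v \<Rightarrow> 'w cpoly"
  shows "psubst f (p * q) = psubst f p * psubst f q"
proof (induction p rule: cpoly_induct)
  case zero then show ?case by (simp add: psubst_zero)
next
  case (add p \<mu> c)
  have "psubst f (Poly_Mapping.single \<mu> c * q) = psubst f (Poly_Mapping.single \<mu> c) * psubst f q"
  proof (induction q rule: cpoly_induct)
    case zero then show ?case by (simp add: psubst_zero)
  next
    case (add q \<nu> d)
    have "Const (c * d) = (Const c * Const d :: 'w cpoly)"
      by (simp add: Const_def mult_single)
    then have "psubst f (Poly_Mapping.single \<mu> c * Poly_Mapping.single \<nu> d)
        = psubst f (Poly_Mapping.single \<mu> c) * psubst f (Poly_Mapping.single \<nu> d)"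
      by (simp add: mult_single psubst_single monomial_add mult_ac)
    with add show ?case by (simp add: distrib_left psubst_add)
  qed
  with add show ?case by (simp add: distrib_right psubst_add)
qed

lemma psubst_power: "psubst f (p ^ n) = psubst f p ^ n"
  by (induction n) (simp_all add: psubst_one psubst_mult)

end

theory Submission
  imports Defs
begin

lemma psubst_prod: "psubst f (\<Prod>v\<in>A. g v) = (\<Prod>v\<in>A. psubst f (g v))"
  by (induction A rule: infinite_finite_induct) (simp_all add: psubst_one psubst_mult)

text \<open>Both sides are additive in \<open>p\<close>, so it is enough to compare them on a single
  term, where multiplicativity of \<open>psubst f\<close> reduces the claim to the images of the
  variables.\<close>

lemma psubst_psubst: "psubst f (psubst g p) = psubst (\<lambda>v. psubst f (g v)) p"
proof (induction p rule: cpoly_induct)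
  case zero
  show ?case by (simp add: psubst_zero)
next
  case (add p \<mu> c)
  have "psubst f (psubst g (Poly_Mapping.single \<mu> c))
      = psubst (\<lambda>v. psubst f (g v)) (Poly_Mapping.single \<mu> c)"
    by (simp add: psubst_single psubst_mult psubst_Const psubst_prod psubst_power)
  with add show ?case by (simp add: psubst_add)
qed

text \<open>Composed substitutions merge into one. This turns the exchange of \<open>W\<close> and
  \<open>Wbar\<close> in the recursion of \<open>Q1\<close> and \<open>Q2\<close> into an exchange
  of arguments.\<close>

lemma at_w_swap: "at_w (at_w q Wbar W) a b = at_w q b a"
  unfolding at_w_def psubst_psubst
  by (rule arg_cong[where f = "\<lambda>f. psubst f q"]) (auto simp: psubst_Var split: w_var.split)

text \<open>\<open>sigma0\<close> is itself a substitution fixing the coefficients, so it acts only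
  on the arguments; for \<open>Z ^ m\<close> and \<open>Zbar ^ m\<close> it exchanges them.\<close>

lemma sigma0_at_w: "sigma0 (at_w q a b) = at_w q (sigma0 a) (sigma0 b)"
  unfolding at_w_def sigma0_def psubst_psubst
  by (rule arg_cong[where f = "\<lambda>f. psubst f q"]) (auto split: w_var.split)

lemma at_w_Q1_Suc:
  "at_w (Q1 \<kappa> lam (Suc n)) a b
    = a * at_w (Q1 \<kappa> lam n) a b + rconst (\<kappa> / (lam + real n + 1)) * b * at_w (Q2 \<kappa> lam n) b a"
  using at_w_swap[of "Q2 \<kappa> lam n" a b]
  by (simp add: at_w_def psubst_add psubst_mult psubst_Const psubst_Var)

lemma at_w_Q2_Suc:
  "at_w (Q2 \<kappa> lam (Suc n)) a b
    = rconst (\<kappa> / (lam + real n + 1)) * b * at_w (Q1 \<kappa> lam n) b a + a * at_w (Q2 \<kappa> lam n) a b"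
  using at_w_swap[of "Q1 \<kappa> lam n" a b]
  by (simp add: at_w_def psubst_add psubst_mult psubst_Const psubst_Var)

lemma sigma0_add: "sigma0 (p + q) = sigma0 p + sigma0 q"
  by (simp add: sigma0_def psubst_add)

lemma sigma0_mult: "sigma0 (p * q) = sigma0 p * sigma0 q"
  by (simp add: sigma0_def psubst_mult)

lemma sigma0_power: "sigma0 (p ^ n) = sigma0 p ^ n"
  by (simp add: sigma0_def psubst_power)

lemma sigma0_Var:
  "sigma0 Z = Zbar" "sigma0 Zbar = Z" "sigma0 T = Tbar" "sigma0 Tbar = T"
  by (simp_all add: sigma0_def psubst_Var)

text \<open>Both families are instances of one recursion: \<open>P1\<close> with \<open>k = m - l\<close> and \<open>(s, s') = (T, Tbar)\<close>,
  \<open>P2\<close> with \<open>k = l\<close> and \<open>(s, s') = (Tbar, T)\<close>.\<close>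

lemma recursion_closed_form:
  fixes P :: "nat \<Rightarrow> zt_var cpoly"
  assumes "m > 0"
    and swap: "sigma0 s = s'" "sigma0 s' = s"
    and P_0: "P 0 = Z ^ (k + 1) * s + rconst (real m * \<kappa> / real k) * Z * Zbar ^ k * s'"
    and P_Suc: "\<And>n. P (Suc n) = Z ^ m * P n
      + rconst (real m * \<kappa> / ((real n + 1) * real m + real k)) * Z * Zbar ^ (m - 1) * sigma0 (P n)"
  shows "P n = Z ^ (k + 1) * at_w (Q1 \<kappa> (real k / real m) n) (Z ^ m) (Zbar ^ m) * s
    + Z * Zbar ^ k * at_w (Q2 \<kappa> (real k / real m) n) (Z ^ m) (Zbar ^ m) * s'"
proof (induction n)
  case 0
  have "\<kappa> / (real k / real m) = real m * \<kappa> / real k"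
    by simp
  then show ?case
    by (simp add: P_0 at_w_def psubst_one psubst_Const mult_ac)
next
  case (Suc n)
  define A :: "zt_var cpoly \<Rightarrow> zt_var cpoly \<Rightarrow> zt_var cpoly"
    where "A = at_w (Q1 \<kappa> (real k / real m) n)"
  define B :: "zt_var cpoly \<Rightarrow> zt_var cpoly \<Rightarrow> zt_var cpoly"
    where "B = at_w (Q2 \<kappa> (real k / real m) n)"
  define c :: "zt_var cpoly" where "c = rconst (\<kappa> / (real k / real m + real n + 1))"
  \<comment> \<open>With \<lambda> = k/m the denominator (n+1)m + k equals m(\<lambda> + n + 1), so
    the factor m cancels.\<close>
  have "real m * \<kappa> / ((real n + 1) * real m + real k)
      = real m * \<kappa> / (real m * (real k / real m + real n + 1))"
    using \<open>m > 0\<close> by (simp add: algebra_simps)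
  also have "\<dots> = \<kappa> / (real k / real m + real n + 1)"
    using \<open>m > 0\<close> by (simp del: times_divide_eq_right)
  finally have coeff: "rconst (real m * \<kappa> / ((real n + 1) * real m + real k)) = c"
    by (simp add: c_def)
  have IH: "P n = Z ^ (k + 1) * A (Z ^ m) (Zbar ^ m) * s + Z * Zbar ^ k * B (Z ^ m) (Zbar ^ m) * s'"
    using Suc.IH by (simp add: A_def B_def)
  \<comment> \<open>Since \<open>s\<close> and \<open>s'\<close> are exchanged too, the
    \<open>A\<close> term moves to \<open>s'\<close> and the \<open>B\<close> term to
    \<open>s\<close>: this is the coupling of \<open>Q1\<close> with \<open>Q2\<close>.\<close>
  have sigma0_IH: "sigma0 (P n)
      = Zbar ^ (k + 1) * A (Zbar ^ m) (Z ^ m) * s' + Zbar * Z ^ k * B (Zbar ^ m) (Z ^ m) * s"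
    by (simp add: IH A_def B_def sigma0_add sigma0_mult sigma0_power sigma0_at_w sigma0_Var swap)
  \<comment> \<open>The spare factor \<open>Zbar\<close> in both terms of
    \<open>sigma0 (P n)\<close> completes \<open>Zbar ^ (m - 1)\<close> from the recursion to the
    second argument \<open>Zbar ^ m\<close>.\<close>
  have Zbar_m: "Zbar ^ m = Zbar * Zbar ^ (m - 1)"
    using \<open>m > 0\<close> by (simp flip: power_Suc)
  have "P (Suc n) = Z ^ (k + 1) * (Z ^ m * A (Z ^ m) (Zbar ^ m)
        + c * (Zbar * Zbar ^ (m - 1)) * B (Zbar ^ m) (Z ^ m)) * s
      + Z * Zbar ^ k * (c * (Zbar * Zbar ^ (m - 1)) * A (Zbar ^ m) (Z ^ m)
        + Z ^ m * B (Z ^ m) (Zbar ^ m)) * s'"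
    unfolding P_Suc coeff sigma0_IH unfolding IH by (simp add: algebra_simps)
  then show ?case
    unfolding at_w_Q1_Suc at_w_Q2_Suc A_def B_def c_def Zbar_m[symmetric] .
qed

theorem proposition4:
  fixes m l n :: nat and \<kappa> :: real
  assumes "m \<ge> 3" and "1 \<le> l" and "l \<le> (m - 1) div 2"
  shows "P1 m l \<kappa> n
      = Z ^ (m - l + 1) * at_w (Q1 \<kappa> ((real m - real l) / real m) n) (Z ^ m) (Zbar ^ m) * T
        + Z * Zbar ^ (m - l) * at_w (Q2 \<kappa> ((real m - real l) / real m) n) (Z ^ m) (Zbar ^ m) * Tbar
    \<and> P2 m l \<kappa> n
      = Z ^ (l + 1) * at_w (Q1 \<kappa> (real l / real m) n) (Z ^ m) (Zbar ^ m) * Tbar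
        + Z * Zbar ^ l * at_w (Q2 \<kappa> (real l / real m) n) (Z ^ m) (Zbar ^ m) * T"
proof -
  \<comment> \<open>The bound on \<open>l\<close> gives \<open>l\<close> \<le> \<open>m\<close>, so
    the truncated subtraction in the exponents agrees with the real one in the coefficients.\<close>
  have "m > 0" and k: "real m - real l = real (m - l)"
    using assms by auto
  show ?thesis
    unfolding k
    by (intro conjI recursion_closed_form[OF \<open>m > 0\<close>]) (simp_all add: sigma0_Var k)
qed

end
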